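(* Let $k\in\mathbb{Z}^+$ and let $n\geq 2k+1$. Then $$\frac1{n!}\sum_{\pi\in\mathcal{S}_n}\operatorname{inv}(\pi^k)=\frac{n(n-1)}4-\frac{(\tau(k)-1)n}6-\frac{\tau^2(k)-\tau(k)-\tau_{\mathrm{o}}(k)+\sigma(k)}{12}.$$
   Context: $\mathcal{S}_n$ is the symmetric group on $[n]=\{1,\dots,n\}$. For $\pi\in\mathcal{S}_n$, an inversion of $\pi$ is a pair of indices $i<j$ in $[n]$ with $\pi(i)>\pi(j)$, and $\operatorname{inv}(\pi)$ is the number of inversions. For $k\in\mathbb{Z}^+$, $\tau(k)$ is the number of positive divisors of $k$, $\sigma(k)$ is the sum of the positive divisors of $k$, $\nu_2(k)$ is the exponent of $2$ in the prime factorization of $k$, and $\tau_{\mathrm{o}}(k)=\tau(k/2^{\nu_2(k)})$ is the number of odd positive divisors of $k$. *)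

theory Defs
  imports Complex_Main
    "HOL-Combinatorics.Permutations"
    "HOL-Computational_Algebra.Primes"
begin

text \<open>
  The symmetric group on $[n]$ is rendered as the set of functions \<open>p :: nat \<Rightarrow> nat\<close> with
  \<open>p permutes {1..n}\<close> (identity outside \<open>{1..n}\<close>); the group power is \<open>p ^^ k\<close>.
  As such a function does not determine \<open>n\<close>, the number of inversions takes \<open>n\<close> as an
  explicit argument.
\<close>

definition inv_number :: "nat \<Rightarrow> (nat \<Rightarrow> nat) \<Rightarrow> nat" where
  "inv_number n p = card {(i, j). i \<in> {1..n} \<and> j \<in> {1..n} \<and> i < j \<and> p i > p j}"

text \<open>
  The divisor functions below are meant for positive arguments only: then every divisor is
  positive and there are finitely many of them.
\<close>

definition divisor_tau :: "nat \<Rightarrow> nat" where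
  "divisor_tau k = card {d. d dvd k}"

definition divisor_sigma :: "nat \<Rightarrow> nat" where
  "divisor_sigma k = (\<Sum>d | d dvd k. d)"

definition divisor_tau_odd :: "nat \<Rightarrow> nat" where
  "divisor_tau_odd k = divisor_tau (k div 2 ^ multiplicity 2 k)"

end

theory Submission
  imports Defs "HOL-Combinatorics.Cycles"
begin

text \<open>
  Summing signs over all ordered pairs, $4\,\mathrm{inv}(q) = n(n-1) - \sum_{a,b}
  \mathrm{sgn}(b-a)\,\mathrm{sgn}(q(b)-q(a))$. The law of $\pi^k$ is invariant under conjugation,
  so one may average over all conjugates of $q$; symmetry under transpositions evaluates the mean
  of $\mathrm{sgn}(s(b)-s(a))\,\mathrm{sgn}(s(d)-s(c))$ over $s \in S_n$, and the average of
  $\mathrm{inv}$ over the conjugates of $q$ depends only on the numbers of fixed points $f$ of $q$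
  and $g$ of $q^2$: it is $n(n-1)/4 - (2nf - 2n + f^2 - g)/12$.
  For $q = \pi^k$, a fixed point of $q$ is an element of a cycle of $\pi$ whose length divides $k$.
  Splitting off this cycle leaves an arbitrary permutation of the other points, which yields
  the means $\tau(k)$ of $f$, $\tau(2k) = \tau(k) + \tau_{\mathrm{o}}(k)$ of $g$, and
  $\sigma(k) + \tau(k)^2$ of $f^2$.
\<close>

section \<open>Inversions and random signs\<close>

text \<open>Off the diagonal the sign product is 1, except that it is -1 at an inversion and at its
  mirror image. Each inversion thus lowers the total n(n-1) twice, by 2 each time, whence the factor
  4.\<close>

lemma inv_number_eq_sum_sgn:
  assumes "q permutes {1..n}"
  shows "4 * real (inv_number n q) = real n * (real n - 1)
    - (\<Sum>a\<in>{1..n}. \<Sum>b\<in>{1..n}. sgn (real b - real a) * sgn (real (q b) - real (q a)))"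
proof -
  let ?N = "{1..n}"
  define I where "I = {(i, j). i \<in> ?N \<and> j \<in> ?N \<and> i < j \<and> q i > q j}"
  have sub: "I \<subseteq> ?N \<times> ?N" "prod.swap ` I \<subseteq> ?N \<times> ?N" by (auto simp: I_def)
  have fin: "finite I" using sub finite_subset by blast
  have inj: "q a = q b \<longleftrightarrow> a = b" for a b using permutes_inj[OF assms] by (auto dest: injD)
  have "(\<Sum>a\<in>?N. \<Sum>b\<in>?N. sgn (real b - real a) * sgn (real (q b) - real (q a)))
      = (\<Sum>(a,b)\<in>?N\<times>?N. (1 - of_bool (a = b)) - 2 * of_bool ((a,b) \<in> I) - 2 * of_bool ((a,b) \<in> prod.swap ` I))"
    unfolding sum.cartesian_product
  proof (intro sum.cong refl, clarsimp simp only: split_conv, goal_cases)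
    case (1 a b)
    then show ?case using inj[of a b]
      by (cases a b rule: linorder_cases; cases "q a" "q b" rule: linorder_cases)
         (auto simp: I_def sgn_if image_iff)
  qed
  also have "\<dots> = (\<Sum>a\<in>?N. \<Sum>b\<in>?N. 1 - of_bool (a = b)) - 2 * (\<Sum>x\<in>?N\<times>?N. of_bool (x \<in> I))
      - 2 * (\<Sum>x\<in>?N\<times>?N. of_bool (x \<in> prod.swap ` I))"
    by (simp only: sum.cartesian_product case_prod_unfold sum_subtractf sum_distrib_left prod.collapse)
  also have "(\<Sum>a\<in>?N. \<Sum>b\<in>?N. 1 - of_bool (a = b)) = real n * (real n - 1)"
    by (simp add: sum_subtractf of_bool_def algebra_simps)
  also have "(\<Sum>x\<in>?N\<times>?N. of_bool (x \<in> I)) = real (card I)"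
    using sub(1) by (simp add: of_bool_def sum.If_cases Int_absorb1)
  also have "(\<Sum>x\<in>?N\<times>?N. of_bool (x \<in> prod.swap ` I)) = real (card (prod.swap ` I))"
    using sub(2) by (simp add: of_bool_def sum.If_cases Int_absorb1)
  also have "card (prod.swap ` I) = card I" by (simp add: card_image)
  finally show ?thesis by (simp add: inv_number_def I_def)
qed

lemma sum_sgn_permutes_sharing:
  fixes S :: "nat set"
  assumes "finite S" "a \<in> S" "b \<in> S" "d \<in> S" "a \<noteq> b" "a \<noteq> d" "b \<noteq> d"
  shows "(\<Sum>s | s permutes S. sgn (real (s b) - real (s a)) * sgn (real (s d) - real (s a))) = fact (card S) / 3"
    (is "?K = _")
proof -
  let ?f = "\<lambda>a b d s. sgn (real (s b) - real (s a)) * sgn (real (s d) - real (s a))"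
  \<comment> \<open>Precomposing s with a transposition only reorders the sum, so b or d may take
    over the role of the common point a.\<close>
  have 1: "?K = (\<Sum>s | s permutes S. ?f b a d s)"
    using assms by (subst sum_permutations_compose_right[OF permutes_swap_id[of a S b]]) auto
  have 2: "?K = (\<Sum>s | s permutes S. ?f d b a s)"
    using assms by (subst sum_permutations_compose_right[OF permutes_swap_id[of a S d]]) auto
  \<comment> \<open>Of three distinct numbers exactly one, the middle one, sees the other two on different sides,
    so the three sign products add up to $1 + 1 - 1$.\<close>
  have "3 * ?K = (\<Sum>s | s permutes S. ?f a b d s) + (\<Sum>s | s permutes S. ?f b a d s) + (\<Sum>s | s permutes S. ?f d b a s)"
    using 1 2 by simp
  also have "\<dots> = (\<Sum>s | s permutes S. ?f a b d s + ?f b a d s + ?f d b a s)"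
    by (simp add: sum.distrib)
  also have "\<dots> = (\<Sum>s | s permutes S. 1)"
  proof (intro sum.cong refl)
    fix s assume "s \<in> {s. s permutes S}"
    then have "inj s" by (simp add: permutes_inj)
    then have "s a \<noteq> s b" "s a \<noteq> s d" "s b \<noteq> s d" using assms by (auto dest: injD)
    then show "?f a b d s + ?f b a d s + ?f d b a s = 1" by (auto simp: sgn_if)
  qed
  also have "\<dots> = fact (card S)" using assms by (simp add: card_permutations)
  finally show ?thesis by simp
qed

text \<open>Exchanging the values at a and b reverses the first sign and leaves the second alone, so
  the sum equals its own negative.\<close>

lemma sum_sgn_permutes_disjoint:
  fixes S :: "nat set"
  assumes "a \<in> S" "b \<in> S" "a \<notin> {c, d}" "b \<notin> {c, d}"
  shows "(\<Sum>s | s permutes S. sgn (real (s b) - real (s a)) * sgn (real (s d) - real (s c))) = 0"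
    (is "?K = _")
proof -
  have "?K = (\<Sum>s | s permutes S. sgn (real (s a) - real (s b)) * sgn (real (s d) - real (s c)))"
    using assms by (subst sum_permutations_compose_right[OF permutes_swap_id[of a S b]]) auto
  also have "\<dots> = - ?K"
    unfolding sum_negf[symmetric]
    by (intro sum.cong refl) (simp add: sgn_if)
  finally show ?thesis by simp
qed

text \<open>Only coincidences among the endpoints matter: an endpoint shared in the same position
  contributes 1/3, a crossed one -1/3, and disjoint pairs give 0. The conjunction terms raise the
  2/3 of two equal pairs to 1; for a = b or c = d everything cancels.\<close>

lemma sum_sgn_permutes:
  fixes S :: "nat set"
  assumes "finite S" "a \<in> S" "b \<in> S" "c \<in> S" "d \<in> S"
  shows "(\<Sum>s | s permutes S. sgn (real (s b) - real (s a)) * sgn (real (s d) - real (s c)))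
    = fact (card S) / 3 * (of_bool (a = c) + of_bool (b = d) - of_bool (a = d) - of_bool (b = c)
        + of_bool (a = c \<and> b = d) - of_bool (a = d \<and> b = c))"
proof -
  define K where "K = (\<lambda>a b c d.
    \<Sum>s | s permutes S. sgn (real (s b) - real (s a)) * sgn (real (s d) - real (s c)))"
  have flip1: "K a b c d = - K b a c d" and flip2: "K a b c d = - K a b d c" for a b c d
    unfolding K_def sum_negf[symmetric] by (auto intro!: sum.cong simp: sgn_if)
  have degenerate: "K a a c d = 0" "K a b c c = 0" for a b c d
    by (simp_all add: K_def)
  have same: "K a b a b = fact (card S)" if "a \<noteq> b" for a b
  proof -
    have "K a b a b = (\<Sum>s | s permutes S. 1)"
      unfolding K_def using that by (intro sum.cong refl) (auto simp: sgn_if dest: permutes_inj injD)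
    then show ?thesis using assms by (simp add: card_permutations)
  qed
  have share: "K a b a d = fact (card S) / 3"
    if "a \<noteq> b" "a \<noteq> d" "b \<noteq> d" "a \<in> S" "b \<in> S" "d \<in> S" for a b d
    unfolding K_def using sum_sgn_permutes_sharing[OF assms(1)] that by blast
  have disj: "K a b c d = 0" if "a \<notin> {c, d}" "b \<notin> {c, d}"
    unfolding K_def using sum_sgn_permutes_disjoint[of a S b c d] that assms by blast
  \<comment> \<open>Apart from degenerate and disjoint pairs, the cases record which endpoints
    coincide. Reversing one or both pairs with \<open>flip1\<close> and \<open>flip2\<close> reduces
    each of them to \<open>same\<close> or \<open>share\<close>.\<close>
  consider "a = b" | "c = d" | "a \<noteq> b" "a = c" "b = d" | "a \<noteq> b" "c \<noteq> d" "a = c" "b \<noteq> d"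
    | "a \<noteq> b" "c \<noteq> d" "a \<noteq> c" "b = d" | "a \<noteq> b" "a = d" "b = c"
    | "a \<noteq> b" "c \<noteq> d" "a = d" "b \<noteq> c" | "a \<noteq> b" "c \<noteq> d" "a \<noteq> d" "b = c"
    | "a \<notin> {c,d}" "b \<notin> {c,d}"
    by auto
  then have "K a b c d = fact (card S) / 3 * (of_bool (a = c) + of_bool (b = d)
      - of_bool (a = d) - of_bool (b = c) + of_bool (a = c \<and> b = d) - of_bool (a = d \<and> b = c))"
  proof cases
    case 1 then show ?thesis using degenerate(1)[of a c d] by (auto simp: of_bool_def)
  next
    case 2 then show ?thesis using degenerate(2)[of a b c] by (auto simp: of_bool_def)
  next
    case 3 then show ?thesis using same[of a b] by simp
  next
    case 4 then show ?thesis using share[of a b d] assms by simp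
  next
    case 5 then show ?thesis using share[of b a c] flip1[of a b c b] flip2[of b a c b] assms by simp
  next
    case 6 then show ?thesis using same[of a b] flip2[of a b b a] by simp
  next
    case 7 then show ?thesis using share[of a b c] flip2[of a b c a] assms by simp
  next
    case 8 then show ?thesis using share[of b a d] flip1[of a b b d] assms by simp
  next
    case 9 then show ?thesis using disj by auto
  qed
  then show ?thesis by (simp only: K_def)
qed

section \<open>Moments of the number of fixed points of a power\<close>

definition fixed_points :: "'a set \<Rightarrow> ('a \<Rightarrow> 'a) \<Rightarrow> 'a set" where
  "fixed_points S f = {a \<in> S. f a = a}"

text \<open>Such a list encodes a cycle with a marked point, its head; a cycle of length d is
  represented by its d rotations. Lists of length 1 stand for fixed points.\<close>

definition distinct_lists_dvd :: "'a set \<Rightarrow> nat \<Rightarrow> 'a list set" where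
  "distinct_lists_dvd S k = {xs. distinct xs \<and> set xs \<subseteq> S \<and> xs \<noteq> [] \<and> length xs dvd k}"

section \<open>Gluing a marked cycle onto a permutation of the other points, and cutting it out
  again\<close>

lemma cycle_of_list_nth:
  assumes "distinct xs" "i < length xs"
  shows "cycle_of_list xs (xs ! i) = xs ! (Suc i mod length xs)"
proof -
  have "cycle_of_list xs (xs ! i) = map (cycle_of_list xs) xs ! i" using assms by simp
  also have "map (cycle_of_list xs) xs = rotate1 xs"
    using cyclic_rotation[OF assms(1), of 1] by simp
  finally show ?thesis using nth_rotate1[OF assms(2)] by simp
qed

context
  fixes S :: "'a set" and xs :: "'a list" and p' :: "'a \<Rightarrow> 'a"
  assumes fin: "finite S" and dist: "distinct xs" and sub: "set xs \<subseteq> S" and ne: "xs \<noteq> []"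
    and perm: "p' permutes S - set xs"
begin

lemma permutes_cycle_of_list_comp: "(cycle_of_list xs \<circ> p') permutes S"
  using permutes_subset[OF cycle_permutes sub] permutes_subset[OF perm Diff_subset]
  by (intro permutes_compose)

lemma funpow_cycle_of_list_comp_nth:
  assumes "i < length xs"
  shows "((cycle_of_list xs \<circ> p') ^^ m) (xs ! i) = xs ! ((i + m) mod length xs)"
proof (induction m)
  case (Suc m)
  have l: "(i + m) mod length xs < length xs" using assms by (intro mod_less_divisor) linarith
  have "p' (xs ! ((i + m) mod length xs)) = xs ! ((i + m) mod length xs)"
    using permutes_not_in[OF perm] l nth_mem by blast
  then show ?case using Suc cycle_of_list_nth[OF dist l] by (simp add: mod_Suc_eq)
qed (use assms in simp)

lemma funpow_cycle_of_list_comp_outside: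
  assumes "b \<in> S - set xs"
  shows "((cycle_of_list xs \<circ> p') ^^ m) b = (p' ^^ m) b"
proof (induction m)
  case (Suc m)
  have "(p' ^^ Suc m) b \<in> S - set xs"
    using permutes_in_image[OF permutes_funpow[OF perm]] assms by blast
  then show ?case using Suc id_outside_supp[of _ xs] by simp
qed simp

text \<open>As the entries are distinct, the head returns to itself exactly at the multiples of
  \<open>length xs\<close>, and two natural numbers with the same multiples are equal.\<close>

lemma least_power_cycle_of_list_comp: "least_power (cycle_of_list xs \<circ> p') (hd xs) = length xs"
proof -
  have "permutation (cycle_of_list xs \<circ> p')"
    using permutes_cycle_of_list_comp fin permutation_permutes by blast
  moreover have "((cycle_of_list xs \<circ> p') ^^ m) (hd xs) = hd xs \<longleftrightarrow> length xs dvd m" for m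
    using funpow_cycle_of_list_comp_nth[of 0 m] ne nth_eq_iff_index_eq[OF dist, of "m mod length xs" 0]
    by (simp add: hd_conv_nth dvd_eq_mod_eq_0)
  ultimately have "least_power (cycle_of_list xs \<circ> p') (hd xs) dvd m \<longleftrightarrow> length xs dvd m" for m
    by (simp only: least_power_dvd)
  then show ?thesis by (meson dvd_antisym dvd_refl)
qed

text \<open>The list can be read off from the glued permutation and the head, so gluing loses no
  information.\<close>

lemma support_cycle_of_list_comp: "support (cycle_of_list xs \<circ> p') (hd xs) = xs"
  unfolding least_power_cycle_of_list_comp
  using funpow_cycle_of_list_comp_nth[of 0] ne
  by (intro nth_equalityI) (simp_all add: hd_conv_nth)

text \<open>The k-th power runs through the glued cycle a whole number of times and fixes all of it;
  elsewhere the composite acts as \<open>p'\<close>. This recursion drives the second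
  moment.\<close>

lemma card_fixed_points_cycle_of_list_comp:
  assumes "length xs dvd k"
  shows "card (fixed_points S ((cycle_of_list xs \<circ> p') ^^ k))
    = length xs + card (fixed_points (S - set xs) (p' ^^ k))"
proof -
  have "((cycle_of_list xs \<circ> p') ^^ k) b = b" if b: "b \<in> set xs" for b
  proof -
    from b obtain i where "b = xs ! i" "i < length xs" by (auto simp: in_set_conv_nth)
    moreover have "(i + k) mod length xs = i" using assms \<open>i < length xs\<close> by (auto elim!: dvdE)
    ultimately show ?thesis using funpow_cycle_of_list_comp_nth by metis
  qed
  then have "fixed_points S ((cycle_of_list xs \<circ> p') ^^ k) = set xs \<union> fixed_points (S - set xs) (p' ^^ k)"
    unfolding fixed_points_def using funpow_cycle_of_list_comp_outside sub by auto
  also have "card \<dots> = card (set xs) + card (fixed_points (S - set xs) (p' ^^ k))"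
    using fin by (intro card_Un_disjoint) (auto simp: fixed_points_def)
  finally show ?thesis using dist by (simp add: distinct_card)
qed

end

lemma finite_distinct_lists_dvd: "finite S \<Longrightarrow> finite (distinct_lists_dvd S k)"
  unfolding distinct_lists_dvd_def
  by (rule finite_subset[OF _ finite_subset_distinct[of S]]) auto

text \<open>The orbit of a, listed from a, has length \<open>least_power p a\<close>, which divides
  k because \<open>p ^^ k\<close> fixes a. On this orbit p agrees with its cycle, so undoing the
  cycle leaves a permutation of the remaining points.\<close>

lemma support_decomposition:
  assumes "finite S" "p permutes S" "a \<in> fixed_points S (p ^^ k)" "xs = support p a"
  shows "xs \<in> distinct_lists_dvd S k" "hd xs = a"
    "inv (cycle_of_list xs) \<circ> p permutes S - set xs"
    "cycle_of_list xs \<circ> (inv (cycle_of_list xs) \<circ> p) = p"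
proof -
  have pp: "permutation p" using assms permutation_permutes by blast
  note lp = least_power_of_permutation[OF pp, of a]
  have a: "a \<in> S" "(p ^^ k) a = a" using assms by (auto simp: fixed_points_def)
  have sub: "set xs \<subseteq> S"
    using a permutes_in_image[OF permutes_funpow[OF assms(2)]] assms(4) by auto
  show "xs \<in> distinct_lists_dvd S k"
    using cycle_of_permutation[OF pp, of a] sub lp a least_power_dvd[OF pp, of a k]
    by (auto simp: distinct_lists_dvd_def assms(4))
  show "hd xs = a" using lp by (simp add: assms(4) hd_map)
  note cyc = cycle_permutes[of xs]
  show "inv (cycle_of_list xs) \<circ> p permutes S - set xs"
  proof (rule permutes_superset)
    show "inv (cycle_of_list xs) \<circ> p permutes S"
      by (intro permutes_compose assms permutes_inv permutes_subset[OF cyc sub])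
    fix b assume "b \<in> S - (S - set xs)"
    then have "p b = cycle_of_list xs b" using cycle_restrict[OF pp, of b a] assms(4) by auto
    then show "(inv (cycle_of_list xs) \<circ> p) b = b" using permutes_inverses(2)[OF cyc] by simp
  qed
  show "cycle_of_list xs \<circ> (inv (cycle_of_list xs) \<circ> p) = p"
    using permutes_inv_o(1)[OF cyc] by (simp add: comp_assoc[symmetric])
qed

text \<open>Cutting out the cycle through a is a bijection from the pairs (p, a) to the pairs (xs,
  p'), with gluing as its inverse. The weight H is 1 for the first moment and the number of fixed
  points of \<open>p ^^ k\<close> for the second.\<close>

lemma sum_fixed_points_decomposition:
  fixes H :: "('a \<Rightarrow> 'a) \<Rightarrow> 'b::comm_monoid_add"
  assumes "finite S"
  shows "(\<Sum>p | p permutes S. \<Sum>a\<in>fixed_points S (p ^^ k). H p)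
    = (\<Sum>xs\<in>distinct_lists_dvd S k. \<Sum>p' | p' permutes S - set xs. H (cycle_of_list xs \<circ> p'))"
proof -
  have fin: "\<forall>p\<in>{p. p permutes S}. finite (fixed_points S (p ^^ k))"
    "\<forall>xs\<in>distinct_lists_dvd S k. finite {p'. p' permutes S - set xs}"
    using assms by (auto simp: fixed_points_def finite_permutations)
  show ?thesis
    unfolding sum.Sigma[OF finite_permutations[OF assms] fin(1)]
      sum.Sigma[OF finite_distinct_lists_dvd[OF assms] fin(2)]
  proof (rule sum.reindex_bij_witness[where
        j = "\<lambda>(p, a). (support p a, inv (cycle_of_list (support p a)) \<circ> p)" and
        i = "\<lambda>(xs, p'). (cycle_of_list xs \<circ> p', hd xs)"], goal_cases)
    case (1 x)
    then show ?case using support_decomposition[OF assms, of "fst x" "snd x" k] by auto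
  next
    case (2 x)
    then show ?case using support_decomposition[OF assms, of "fst x" "snd x" k] by auto
  next
    case (3 y)
    obtain xs p' where y: "y = (xs, p')" by force
    then have h: "distinct xs" "set xs \<subseteq> S" "xs \<noteq> []" "p' permutes S - set xs"
      using 3 by (auto simp: distinct_lists_dvd_def)
    have "inv (cycle_of_list xs) \<circ> (cycle_of_list xs \<circ> p') = p'"
      using permutes_inv_o(2)[OF cycle_permutes[of xs]] by (simp add: comp_assoc[symmetric])
    then show ?case using support_cycle_of_list_comp[OF assms h] by (simp add: y)
  next
    case (4 y)
    obtain xs p' where y: "y = (xs, p')" by force
    then have h: "distinct xs" "set xs \<subseteq> S" "xs \<noteq> []" "p' permutes S - set xs" "length xs dvd k"
      using 4 by (auto simp: distinct_lists_dvd_def)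
    have "((cycle_of_list xs \<circ> p') ^^ k) (hd xs) = hd xs"
      using funpow_cycle_of_list_comp_nth[OF assms h(1-4), of 0 k] h by (simp add: hd_conv_nth)
    then show ?case using permutes_cycle_of_list_comp[OF assms h(1-4)] h
      by (auto simp: y fixed_points_def)
  next
    case (5 x)
    then show ?case using support_decomposition[OF assms, of "fst x" "snd x" k] by auto
  qed
qed

section \<open>Counting marked cycles, and the first two moments\<close>

lemma card_distinct_lists:
  assumes "finite S" "d \<le> card S"
  shows "card {xs. length xs = d \<and> distinct xs \<and> set xs \<subseteq> S} * fact (card S - d) = fact (card S)"
proof -
  have "card {xs. length xs = d \<and> distinct xs \<and> set xs \<subseteq> S} = fact (card S) div fact (card S - d)"
    using card_lists_distinct_length_eq[OF assms] fact_div_fact[of "card S - d" "card S"] by simp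
  then show ?thesis by (simp only: dvd_div_mult_self[OF fact_dvd[OF diff_le_self]])
qed

text \<open>Group the lists by their length d. The number of lists times the (card S - d)!
  permutations of the other points is (card S)! for every d, so all divisors of k carry the same
  weight.\<close>

lemma sum_distinct_lists_dvd:
  fixes g :: "nat \<Rightarrow> nat"
  assumes "finite S" "k \<ge> 1" "card S \<ge> k"
  shows "(\<Sum>xs\<in>distinct_lists_dvd S k. fact (card S - length xs) * g (length xs))
    = fact (card S) * (\<Sum>d | d dvd k. g d)"
proof -
  let ?L = "\<lambda>d. {xs. length xs = d \<and> distinct xs \<and> set xs \<subseteq> S}"
  have fin: "finite {d. d dvd k}" using assms by simp
  have "(\<Sum>xs\<in>distinct_lists_dvd S k. fact (card S - length xs) * g (length xs))
     = (\<Sum>d | d dvd k. \<Sum>xs | xs \<in> distinct_lists_dvd S k \<and> length xs = d. fact (card S - length xs) * g (length xs))"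
    by (rule sum.group[symmetric, OF finite_distinct_lists_dvd[OF assms(1)] fin])
       (auto simp: distinct_lists_dvd_def)
  also have "\<dots> = (\<Sum>d | d dvd k. \<Sum>xs\<in>?L d. fact (card S - d) * g d)"
    using assms by (intro sum.cong) (auto simp: distinct_lists_dvd_def)
  also have "\<dots> = (\<Sum>d | d dvd k. fact (card S) * g d)"
  proof (intro sum.cong refl)
    fix d assume "d \<in> {d. d dvd k}"
    then have "d \<le> card S" using assms dvd_imp_le[of d k] by auto
    then have "card (?L d) * fact (card S - d) = fact (card S)"
      using card_distinct_lists[OF assms(1)] by simp
    then show "(\<Sum>xs\<in>?L d. fact (card S - d) * g d) = fact (card S) * g d"
      by (simp add: mult.assoc[symmetric])
  qed
  finally show ?thesis by (simp add: sum_distrib_left)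
qed

lemma sum_card_fixed_points_funpow:
  assumes "finite S" "k \<ge> 1" "card S \<ge> k"
  shows "(\<Sum>p | p permutes S. card (fixed_points S (p ^^ k))) = fact (card S) * divisor_tau k"
proof -
  have "(\<Sum>p | p permutes S. card (fixed_points S (p ^^ k)))
      = (\<Sum>p | p permutes S. \<Sum>a\<in>fixed_points S (p ^^ k). 1)" by simp
  also have "\<dots> = (\<Sum>xs\<in>distinct_lists_dvd S k. fact (card S - length xs) * 1)"
    unfolding sum_fixed_points_decomposition[OF assms(1)]
    using assms(1)
    by (intro sum.cong refl)
       (auto simp: distinct_lists_dvd_def card_permutations card_Diff_subset distinct_card)
  also have "\<dots> = fact (card S) * divisor_tau k"
    using sum_distinct_lists_dvd[OF assms, of "\<lambda>_. 1"] by (simp add: divisor_tau_def)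
  finally show ?thesis .
qed

lemma sum_card_fixed_points_funpow_squared:
  assumes "finite S" "k \<ge> 1" "card S \<ge> 2 * k"
  shows "(\<Sum>p | p permutes S. (card (fixed_points S (p ^^ k)))\<^sup>2)
    = fact (card S) * (divisor_sigma k + (divisor_tau k)\<^sup>2)"
proof -
  have "(\<Sum>p | p permutes S. (card (fixed_points S (p ^^ k)))\<^sup>2)
      = (\<Sum>p | p permutes S. \<Sum>a\<in>fixed_points S (p ^^ k). card (fixed_points S (p ^^ k)))"
    by (simp add: power2_eq_square)
  also have "\<dots> = (\<Sum>xs\<in>distinct_lists_dvd S k. \<Sum>p' | p' permutes S - set xs.
      card (fixed_points S ((cycle_of_list xs \<circ> p') ^^ k)))"
    by (rule sum_fixed_points_decomposition[OF assms(1)])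
  also have "\<dots> = (\<Sum>xs\<in>distinct_lists_dvd S k. fact (card S - length xs) * (length xs + divisor_tau k))"
  proof (intro sum.cong refl)
    fix xs assume "xs \<in> distinct_lists_dvd S k"
    then have h: "distinct xs" "set xs \<subseteq> S" "xs \<noteq> []" "length xs dvd k"
      by (auto simp: distinct_lists_dvd_def)
    have fin: "finite (S - set xs)" using assms by simp
    have card: "card (S - set xs) = card S - length xs"
      using h assms by (simp add: card_Diff_subset distinct_card)
    \<comment> \<open>Removing at most k of at least 2k points leaves the k points that the first
      moment requires.\<close>
    have "length xs \<le> k" using h assms by (auto dest: dvd_imp_le)
    then have "card (S - set xs) \<ge> k" using card assms by simp
    then have "(\<Sum>p' | p' permutes S - set xs. card (fixed_points (S - set xs) (p' ^^ k)))
        = fact (card S - length xs) * divisor_tau k"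
      using sum_card_fixed_points_funpow[OF fin assms(2)] card by simp
    moreover have "(\<Sum>p' | p' permutes S - set xs. card (fixed_points S ((cycle_of_list xs \<circ> p') ^^ k)))
        = (\<Sum>p' | p' permutes S - set xs. length xs + card (fixed_points (S - set xs) (p' ^^ k)))"
      using card_fixed_points_cycle_of_list_comp[OF assms(1) h(1-3) _ h(4)] by (intro sum.cong) auto
    ultimately show "(\<Sum>p' | p' permutes S - set xs. card (fixed_points S ((cycle_of_list xs \<circ> p') ^^ k)))
        = fact (card S - length xs) * (length xs + divisor_tau k)"
      using card_permutations[OF card fin] by (simp add: sum.distrib algebra_simps)
  qed
  also have "\<dots> = fact (card S) * (\<Sum>d | d dvd k. d + divisor_tau k)"
    using sum_distinct_lists_dvd[of S k "\<lambda>d. d + divisor_tau k"] assms by simp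
  also have "(\<Sum>d | d dvd k. d + divisor_tau k) = divisor_sigma k + (divisor_tau k)\<^sup>2"
    by (simp add: sum.distrib divisor_sigma_def divisor_tau_def power2_eq_square)
  finally show ?thesis .
qed

text \<open>With k = 2^v m and m odd, the divisors of 2k that do not divide k are those containing
  the full power 2^(v+1), that is, 2^(v+1) e with e dividing m.\<close>

lemma divisor_tau_double:
  assumes "k \<ge> 1"
  shows "divisor_tau (2 * k) = divisor_tau k + divisor_tau_odd k"
proof -
  define v m where "v = multiplicity 2 k" and "m = k div 2 ^ v"
  have k: "k = 2 ^ v * m" by (simp add: v_def m_def multiplicity_dvd)
  have m: "odd m"
    using multiplicity_decompose[of k 2] assms by (simp add: m_def v_def)
  have "{d. d dvd 2 * k} = {d. d dvd k} \<union> (*) (2 ^ Suc v) ` {e. e dvd m}"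
  proof (intro equalityI subsetI)
    fix d assume "d \<in> {d. d dvd 2 * k}"
    then have d: "d dvd 2 ^ Suc v * m" using k by (simp add: mult.assoc)
    then have "d \<noteq> 0" using assms k by (intro notI) simp
    define j e where "j = multiplicity 2 d" and "e = d div 2 ^ j"
    have de: "d = 2 ^ j * e" by (simp add: j_def e_def multiplicity_dvd)
    have e: "odd e" using multiplicity_decompose[of d 2] \<open>d \<noteq> 0\<close> by (simp add: j_def e_def)
    have "e dvd 2 ^ Suc v * m" using d de dvd_mult_right by blast
    then have em: "e dvd m" using e by (simp add: coprime_dvd_mult_right_iff)
    have "2 ^ j dvd 2 ^ Suc v * m" using d de dvd_mult_left by blast
    then have "(2::nat) ^ j dvd 2 ^ Suc v" using m by (simp add: coprime_dvd_mult_left_iff)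
    then have "j \<le> Suc v" using power_dvd_imp_le by fastforce
    then consider "j = Suc v" | "j \<le> v" by linarith
    then show "d \<in> {d. d dvd k} \<union> (*) (2 ^ Suc v) ` {e. e dvd m}"
    proof cases
      case 1 then show ?thesis using de em by blast
    next
      case 2 then have "d dvd k" unfolding de k by (intro mult_dvd_mono em le_imp_power_dvd)
      then show ?thesis by blast
    qed
  next
    fix d assume "d \<in> {d. d dvd k} \<union> (*) (2 ^ Suc v) ` {e. e dvd m}"
    then show "d \<in> {d. d dvd 2 * k}" using k by (auto simp: mult.assoc)
  qed
  moreover have "{d. d dvd k} \<inter> (*) (2 ^ Suc v) ` {e. e dvd m} = {}"
  proof (rule ccontr)
    assume "\<not> ?thesis"
    then obtain e where "2 ^ Suc v * e dvd 2 ^ v * m" using k by auto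
    then have "2 * e dvd m" by (simp add: mult.assoc mult.left_commute)
    then show False using m by (meson dvd_mult_left)
  qed
  moreover have "finite {d. d dvd k}" "finite {e. e dvd m}" using assms m by (auto intro!: finite_divisors_nat odd_pos)
  moreover have "inj ((*) (2 ^ Suc v :: nat))" by (auto intro: injI)
  ultimately have "divisor_tau (2 * k) = divisor_tau k + divisor_tau m"
    unfolding divisor_tau_def by (simp add: card_Un_disjoint card_image inj_on_subset)
  then show ?thesis by (simp add: divisor_tau_odd_def m_def v_def)
qed

section \<open>Averaging over conjugates\<close>

text \<open>Apply \<open>sum_sgn_permutes\<close> with c = q a and d = q b, and count coincidences
  over all pairs (a, b). Each of a = q a and b = q b holds for card S times f pairs, where f is the
  number of fixed points of q; each of a = q b and b = q a holds for card S pairs. Both points are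
  fixed in f^2 pairs.\<close>

lemma sum_sgn_conjugate:
  fixes S :: "nat set"
  assumes "finite S" "q permutes S"
  shows "(\<Sum>s | s permutes S. \<Sum>a\<in>S. \<Sum>b\<in>S.
      sgn (real (s b) - real (s a)) * sgn (real (s (q b)) - real (s (q a))))
    = fact (card S) / 3 * (2 * real (card S) * real (card (fixed_points S q)) - 2 * real (card S)
        + (real (card (fixed_points S q)))\<^sup>2 - real (card (fixed_points S (q ^^ 2))))"
proof -
  let ?f = "\<lambda>a. of_bool (q a = a) :: real"
  have in_S: "q a \<in> S \<longleftrightarrow> a \<in> S" for a using permutes_in_image[OF assms(2)] .
  have inv: "a = q b \<longleftrightarrow> inv q a = b" for a b using permutes_inv_eq[OF assms(2)] by auto
  have fp: "(\<Sum>a\<in>S. of_bool (f a = a)) = real (card (fixed_points S f))" for f :: "nat \<Rightarrow> nat"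
    using assms(1) by (simp add: fixed_points_def of_bool_def sum.If_cases Int_def)
  have one: "(\<Sum>b\<in>S. of_bool (x = b)) = (1::real)" if "x \<in> S" for x
    using assms(1) that by (simp add: of_bool_def)
  \<comment> \<open>Only b = q a can contribute, and then a = q b says that q^2 fixes a.\<close>
  have swap: "(\<Sum>b\<in>S. of_bool (a = q b \<and> b = q a)) = (of_bool ((q ^^ 2) a = a) :: real)" if "a \<in> S" for a
  proof -
    have "(\<Sum>b\<in>S. of_bool (a = q b \<and> b = q a)) = (\<Sum>b\<in>S. of_bool (q a = b) * (of_bool (q (q a) = a) :: real))"
      unfolding of_bool_conj[symmetric] by (intro sum.cong refl arg_cong[where f=of_bool]) metis
    then show ?thesis using one[of "q a"] in_S that by (simp add: sum_distrib_right[symmetric] numeral_2_eq_2)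
  qed
  have "(\<Sum>s | s permutes S. \<Sum>a\<in>S. \<Sum>b\<in>S.
      sgn (real (s b) - real (s a)) * sgn (real (s (q b)) - real (s (q a))))
    = (\<Sum>a\<in>S. \<Sum>b\<in>S. \<Sum>s | s permutes S.
      sgn (real (s b) - real (s a)) * sgn (real (s (q b)) - real (s (q a))))"
    by (subst sum.swap, subst sum.swap[of _ S "{s. s permutes S}"]) (rule refl)
  also have "\<dots> = (\<Sum>a\<in>S. \<Sum>b\<in>S. fact (card S) / 3 *
      (?f a + ?f b - of_bool (inv q a = b) - of_bool (q a = b) + ?f a * ?f b
        - of_bool (a = q b \<and> b = q a)))"
    using assms(1) in_S
    by (intro sum.cong refl, subst sum_sgn_permutes) (auto simp: inv[symmetric])
  also have "\<dots> = fact (card S) / 3 *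
      ((\<Sum>a\<in>S. \<Sum>b\<in>S. ?f a) + (\<Sum>a\<in>S. \<Sum>b\<in>S. ?f b) - (\<Sum>a\<in>S. \<Sum>b\<in>S. of_bool (inv q a = b))
        - (\<Sum>a\<in>S. \<Sum>b\<in>S. of_bool (q a = b)) + (\<Sum>a\<in>S. \<Sum>b\<in>S. ?f a * ?f b)
        - (\<Sum>a\<in>S. \<Sum>b\<in>S. of_bool (a = q b \<and> b = q a)))"
    by (simp only: sum_distrib_left[symmetric] sum.distrib sum_subtractf)
  also have "(\<Sum>a\<in>S. \<Sum>b\<in>S. of_bool (q a = b)) = real (card S)" using one in_S by simp
  also have "(\<Sum>a\<in>S. \<Sum>b\<in>S. of_bool (inv q a = b)) = real (card S)"
    using one permutes_in_image[OF permutes_inv[OF assms(2)]] by simp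
  also have "(\<Sum>a\<in>S. \<Sum>b\<in>S. of_bool (a = q b \<and> b = q a)) = real (card (fixed_points S (q ^^ 2)))"
    unfolding fp[symmetric] by (intro sum.cong refl swap)
  also have "(\<Sum>a\<in>S. \<Sum>b\<in>S. ?f a * ?f b) = (real (card (fixed_points S q)))\<^sup>2"
    unfolding sum_distrib_left[symmetric] sum_distrib_right[symmetric] fp power2_eq_square ..
  also have "(\<Sum>a\<in>S. \<Sum>b\<in>S. ?f a) = real (card S) * real (card (fixed_points S q))"
    by (simp only: sum_constant sum_distrib_left[symmetric] fp)
  also have "(\<Sum>a\<in>S. \<Sum>b\<in>S. ?f b) = real (card S) * real (card (fixed_points S q))"
    by (simp only: sum_constant fp)
  finally show ?thesis by (simp only: algebra_simps)
qed

lemma sum_permutes_conjugate: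
  assumes "s permutes S"
  shows "(\<Sum>p | p permutes S. F (s \<circ> p \<circ> inv s)) = (\<Sum>p | p permutes S. F p)"
  by (rule sum.reindex_bij_witness[where i = "\<lambda>p. inv s \<circ> p \<circ> s" and j = "\<lambda>p. s \<circ> p \<circ> inv s"])
     (auto intro!: permutes_compose permutes_inv assms simp: fun_eq_iff permutes_inverses[OF assms])

lemma funpow_conjugate:
  assumes "s permutes S"
  shows "(s \<circ> p \<circ> inv s) ^^ k = s \<circ> p ^^ k \<circ> inv s"
proof (induction k)
  case 0 then show ?case using permutes_inv_o(1)[OF assms] by simp
next
  case (Suc k) then show ?case by (simp add: fun_eq_iff permutes_inverses(2)[OF assms])
qed

lemma sum_inv_number_conjugate:
  assumes "q permutes {1..n}"
  shows "(\<Sum>s | s permutes {1..n}. real (inv_number n (s \<circ> q \<circ> inv s)))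
    = fact n * (real n * (real n - 1) / 4
      - (2 * real n * real (card (fixed_points {1..n} q)) - 2 * real n
        + (real (card (fixed_points {1..n} q)))\<^sup>2 - real (card (fixed_points {1..n} (q ^^ 2)))) / 12)"
proof -
  let ?N = "{1..n}"
  have "4 * real (inv_number n (s \<circ> q \<circ> inv s)) = real n * (real n - 1)
    - (\<Sum>a\<in>?N. \<Sum>b\<in>?N. sgn (real (s b) - real (s a)) * sgn (real (s (q b)) - real (s (q a))))"
    if s: "s permutes ?N" for s
  proof -
    have "s \<circ> q \<circ> inv s permutes ?N" by (intro permutes_compose permutes_inv s assms)
    \<comment> \<open>Renaming a and b to s a and s b cancels \<open>inv s\<close> inside the
      conjugate.\<close>
    from inv_number_eq_sum_sgn[OF this] show ?thesis
      by (subst (asm) sum.permute[OF s], subst (asm) (2) sum.permute[OF s])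
         (simp add: permutes_inverses(2)[OF s])
  qed
  then have "4 * (\<Sum>s | s permutes ?N. real (inv_number n (s \<circ> q \<circ> inv s)))
     = (\<Sum>s | s permutes ?N. real n * (real n - 1)) - (\<Sum>s | s permutes ?N.
        \<Sum>a\<in>?N. \<Sum>b\<in>?N. sgn (real (s b) - real (s a)) * sgn (real (s (q b)) - real (s (q a))))"
    unfolding sum_distrib_left sum_subtractf[symmetric] by (intro sum.cong refl) auto
  also have "(\<Sum>s | s permutes ?N. real n * (real n - 1)) = fact n * (real n * (real n - 1))"
    by (simp add: card_permutations)
  finally have "4 * (\<Sum>s | s permutes ?N. real (inv_number n (s \<circ> q \<circ> inv s)))
     = fact n * (real n * (real n - 1)) - fact n / 3 * (2 * real n * real (card (fixed_points ?N q)) - 2 * real n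
        + (real (card (fixed_points ?N q)))\<^sup>2 - real (card (fixed_points ?N (q ^^ 2))))"
    unfolding sum_sgn_conjugate[OF finite_atLeastAtMost assms] card_atLeastAtMost diff_Suc_1 .
  moreover have "x = F * (N / 4 - R / 12)" if "4 * x = F * N - F / 3 * R" for x F N R :: real
    using that by (simp add: field_simps)
  ultimately show ?thesis by blast
qed

theorem theorem1p2:
  fixes k n :: nat
  assumes "k \<ge> 1" and "n \<ge> 2 * k + 1"
  shows "1 / fact n * (\<Sum>p | p permutes {1..n}. real (inv_number n (p ^^ k))) =
    real n * (real n - 1) / 4
    - (real (divisor_tau k) - 1) * real n / 6
    - ((real (divisor_tau k))\<^sup>2 - real (divisor_tau k) - real (divisor_tau_odd k)
        + real (divisor_sigma k)) / 12"
proof -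
  let ?N = "{1..n}"
  let ?P = "{p. p permutes ?N}"
  let ?fix = "\<lambda>m p. real (card (fixed_points ?N (p ^^ m)))"
  let ?I = "\<Sum>p\<in>?P. real (inv_number n (p ^^ k))"
  \<comment> \<open>Take n! copies of ?I, one for each s, and reindex each by conjugation with s.
    After exchanging the sums, the inner one runs over the conjugates of a fixed
    \<open>p ^^ k\<close>.\<close>
  have "fact n * ?I = (\<Sum>s\<in>?P. ?I)" by (simp add: card_permutations)
  also have "\<dots> = (\<Sum>s\<in>?P. \<Sum>p\<in>?P. real (inv_number n (s \<circ> p ^^ k \<circ> inv s)))"
  proof (rule sum.cong[OF refl])
    fix s assume "s \<in> ?P"
    then have "s permutes ?N" by simp
    from sum_permutes_conjugate[OF this, of "\<lambda>p. real (inv_number n (p ^^ k))"]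
    show "?I = (\<Sum>p\<in>?P. real (inv_number n (s \<circ> p ^^ k \<circ> inv s)))"
      unfolding funpow_conjugate[OF \<open>s permutes ?N\<close>] by simp
  qed
  also have "\<dots> = (\<Sum>p\<in>?P. \<Sum>s\<in>?P. real (inv_number n (s \<circ> p ^^ k \<circ> inv s)))"
    by (rule sum.swap)
  also have "\<dots> = (\<Sum>p\<in>?P. fact n * (real n * (real n - 1) / 4
      - (2 * real n * ?fix k p - 2 * real n + (?fix k p)\<^sup>2 - ?fix (2 * k) p) / 12))"
    \<comment> \<open>The square of \<open>p ^^ k\<close> is \<open>p ^^ (2 * k)\<close>, so its
      fixed points are governed by the first moment for 2k.\<close>
    using sum_inv_number_conjugate[OF permutes_funpow]
    by (intro sum.cong refl) (simp add: funpow_mult[symmetric] mult.commute[of 2 k])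
  also have "\<dots> = fact n * (fact n * (real n * (real n - 1) / 4)
      - (2 * real n * (\<Sum>p\<in>?P. ?fix k p) - 2 * real n * fact n
        + (\<Sum>p\<in>?P. (?fix k p)\<^sup>2) - (\<Sum>p\<in>?P. ?fix (2 * k) p)) / 12)"
    by (simp add: sum_distrib_left[symmetric] sum_subtractf sum.distrib sum_divide_distrib[symmetric]
        card_permutations)
  finally have "?I = fact n * (real n * (real n - 1) / 4)
      - (2 * real n * (\<Sum>p\<in>?P. ?fix k p) - 2 * real n * fact n
        + (\<Sum>p\<in>?P. (?fix k p)\<^sup>2) - (\<Sum>p\<in>?P. ?fix (2 * k) p)) / 12"
    by simp
  \<comment> \<open>This serves both m = k and m = 2k, which are at most n.\<close>
  moreover have "(\<Sum>p\<in>?P. ?fix m p) = fact n * real (divisor_tau m)" if "1 \<le> m" "m \<le> n" for m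
    using arg_cong[OF sum_card_fixed_points_funpow[of ?N m], of real] that by simp
  moreover have "(\<Sum>p\<in>?P. (?fix k p)\<^sup>2) = fact n * (real (divisor_sigma k) + (real (divisor_tau k))\<^sup>2)"
    using arg_cong[OF sum_card_fixed_points_funpow_squared[of ?N k], of real] assms by simp
  moreover have "real (divisor_tau (2 * k)) = real (divisor_tau k) + real (divisor_tau_odd k)"
    using divisor_tau_double[OF assms(1)] by simp
  ultimately show ?thesis using assms by (simp add: field_simps)
qed

end
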